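(* Let $C\in\Bbbk$, let $X$ be a submultiset of $R_{u+C}$ and let $Y=R_{u+C}\setminus X$. Then $t$ is minimal in $\mathcal{L}_C(X)\setminus\{1\}$ (with respect to divisibility) if and only if one of the following conditions holds: (a) $t=0$ and $(X-Y)\cap\mathbb{Z}_{\geq 1}=\emptyset$ (i.e., $A_C(X)$ is simple); (b) $R_t$ is a finite gapless $(p,q)$-chain with no repeated elements, say $\alpha_1\prec\cdots\prec\alpha_k$, with $\deg t=k$, such that: (i) there is no $i<k$ with $\alpha_i\in X$; and (ii) there is no $i>1$ with $\alpha_i-1\in Y$.
   Context: $\Bbbk$ is an algebraically closed field of characteristic zero. Fix a nonzero polynomial $g(h)\in\Bbbk[h]$ and a polynomial $u(h)\in\Bbbk[h]$ with $g(h)=u(h-1)-u(h)$ (such $u$ exists, is unique up to its constant term, and $\deg u=\deg g+1\geq 1$). The Smith algebra $\mathcal{S}_u$ is the unital associative $\Bbbk$-algebra generated by $x,y,h$ with defining relations $[h,y]=y$, $[h,x]=-x$, $[y,x]=g(h)$. $R_f$ denotes the multiset of roots of a nonzero polynomial $f$ (with multiplicity); by convention $R_0=\Bbbk$ (infinite). Multiset differences are taken with multiplicity. $X-Y=\{\beta-\alpha\mid\beta\in X,\alpha\in Y\}$. For $C\in\Bbbk$ and a submultiset $X\subseteq R_{u+C}$, put $q(h)=\prod_{\alpha\in X}(h-\alpha)$ (with multiplicity; empty product $=1$) and $p(h)=\frac{u(h-1)+C}{q(h-1)}\in\Bbbk[h]$; thus $X=R_q$ and $Y=R_{p(h+1)}$.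 The module $A_C(X)$ is $\Bbbk[h]$ with $h$ acting by multiplication and $x\cdot f(h)=f(h+1)q(h)$, $y\cdot f(h)=f(h-1)p(h)$ for all $f\in\Bbbk[h]$. Define $\mathcal{L}_C(X)=\{t(h)\in\Bbbk[h]\mid t\text{ is monic},\ t(h)\mid t(h-1)p(h)\text{ and }t(h)\mid t(h+1)q(h)\}\cup\{0\}$, a poset under divisibility ($s\leq t$ iff $s\mid t$; every element divides $0$). Define a partial order on $\Bbbk$ by $\alpha\preccurlyeq\beta$ iff $\beta-\alpha=n1_\Bbbk$ for some integer $n\geq 0$, and write $\alpha\prec\beta$ if moreover $\alpha\neq\beta$. A $(p,q)$-chain is a finite nonempty multiset $\alpha_1\preccurlyeq\cdots\preccurlyeq\alpha_k$ ($k\geq 1$) of elements of $\Bbbk$ such that $\alpha_1$ is a root of $p$ (i.e. $\alpha_1-1\in Y$) and $\alpha_k$ is a root of $q$ (i.e. $\alpha_k\in X$). The chain is gapless if $\alpha_{i+1}-\alpha_i\in\{0,1\}$ for all $1\leq i<k$. *)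

theory Defs
  imports "HOL-Computational_Algebra.Computational_Algebra"
begin

definition shift :: "'a::comm_ring_1 \<Rightarrow> 'a poly \<Rightarrow> 'a poly" where
  "shift c f = pcompose f [:c, 1:]"

text \<open>
  \<open>R\<^sub>f\<close> is \<^const>\<open>proots\<close>, which agrees with the usual root multiset only for \<open>f \<noteq> 0\<close>
  (\<open>proots 0 = {#}\<close>, whereas \<open>R\<^sub>0\<close> is conventionally the whole field); statements about the
  roots of a possibly zero polynomial therefore carry an explicit \<open>\<noteq> 0\<close>.
\<close>

definition q_poly :: "'a::field multiset \<Rightarrow> 'a poly" where
  "q_poly X = (\<Prod>\<alpha>\<in>#X. [:-\<alpha>, 1:])"

text \<open>
  The division is exact whenever \<open>X\<close> is a submultiset of \<open>R\<^bsub>u+C\<^esub>\<close>; see \<open>p_poly_mult\<close>.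
\<close>
definition p_poly :: "'a::field poly \<Rightarrow> 'a \<Rightarrow> 'a multiset \<Rightarrow> 'a poly" where
  "p_poly u C X = (shift (-1) u + [:C:]) div shift (-1) (q_poly X)"

text \<open>
  A left module over the Smith algebra, the unital algebra on generators \<open>x, y, h\<close> with relations
  \<open>[h,y] = y\<close>, \<open>[h,x] = -x\<close>, \<open>[y,x] = g(h)\<close>, is the same thing as a vector space with three linear
  operators satisfying these relations; its submodules are the subspaces stable under
  the three operators.
\<close>
locale smith_module = vector_space scale
  for scale :: "'k::field \<Rightarrow> 'v::ab_group_add \<Rightarrow> 'v" (infixr \<open>*s\<close> 75) +
  fixes g :: "'k poly" and hop xop yop :: "'v \<Rightarrow> 'v"
  assumes linear_h: "Vector_Spaces.linear scale scale hop"
    and linear_x: "Vector_Spaces.linear scale scale xop"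
    and linear_y: "Vector_Spaces.linear scale scale yop"
    and rel_hy: "hop (yop v) - yop (hop v) = yop v"
    and rel_hx: "hop (xop v) - xop (hop v) = - xop v"
    and rel_yx: "yop (xop v) - xop (yop v) = (\<Sum>i\<le>degree g. coeff g i *s (hop ^^ i) v)"
begin

definition submodule :: "'v set \<Rightarrow> bool" where
  "submodule W \<longleftrightarrow> subspace W \<and> hop ` W \<subseteq> W \<and> xop ` W \<subseteq> W \<and> yop ` W \<subseteq> W"

end

definition simple_smith_module ::
    "('k::field \<Rightarrow> 'v::ab_group_add \<Rightarrow> 'v) \<Rightarrow> 'k poly \<Rightarrow> ('v \<Rightarrow> 'v) \<Rightarrow> ('v \<Rightarrow> 'v) \<Rightarrow> ('v \<Rightarrow> 'v) \<Rightarrow> bool" where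
  "simple_smith_module scale g hop xop yop \<longleftrightarrow>
     smith_module scale g hop xop yop \<and> (UNIV :: 'v set) \<noteq> {0} \<and>
     (\<forall>W. smith_module.submodule scale hop xop yop W \<longrightarrow> W = {0} \<or> W = UNIV)"

definition act_h :: "'a::field poly \<Rightarrow> 'a poly" where
  "act_h f = [:0, 1:] * f"

definition act_x :: "'a::field multiset \<Rightarrow> 'a poly \<Rightarrow> 'a poly" where
  "act_x X f = shift 1 f * q_poly X"

definition act_y :: "'a::field poly \<Rightarrow> 'a \<Rightarrow> 'a multiset \<Rightarrow> 'a poly \<Rightarrow> 'a poly" where
  "act_y u C X f = shift (-1) f * p_poly u C X"

definition simple_A :: "'a::field poly \<Rightarrow> 'a poly \<Rightarrow> 'a \<Rightarrow> 'a multiset \<Rightarrow> bool" where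
  "simple_A g u C X \<longleftrightarrow> simple_smith_module smult g act_h (act_x X) (act_y u C X)"

definition L_poset :: "'a::field poly \<Rightarrow> 'a \<Rightarrow> 'a multiset \<Rightarrow> 'a poly set" where
  "L_poset u C X =
     {t. lead_coeff t = 1 \<and> t dvd shift (-1) t * p_poly u C X \<and> t dvd shift 1 t * q_poly X} \<union> {0}"

definition minimal_dvd_in :: "'b::comm_semiring_1 set \<Rightarrow> 'b \<Rightarrow> bool" where
  "minimal_dvd_in S t \<longleftrightarrow> t \<in> S \<and> (\<forall>s\<in>S. s dvd t \<longrightarrow> s = t)"

definition diff_set :: "'a::field multiset \<Rightarrow> 'a multiset \<Rightarrow> 'a set" where
  "diff_set X Y = {\<beta> - \<alpha> | \<beta> \<alpha>. \<beta> \<in># X \<and> \<alpha> \<in># Y}"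

definition preceq :: "'a::field \<Rightarrow> 'a \<Rightarrow> bool" where
  "preceq \<alpha> \<beta> \<longleftrightarrow> (\<exists>n::nat. \<beta> - \<alpha> = of_nat n)"

definition prec :: "'a::field \<Rightarrow> 'a \<Rightarrow> bool" where
  "prec \<alpha> \<beta> \<longleftrightarrow> preceq \<alpha> \<beta> \<and> \<alpha> \<noteq> \<beta>"

text \<open>
  Chains are multisets; they are represented by the list \<open>\<alpha>\<^sub>1, \<dots>, \<alpha>\<^sub>k\<close> of their elements in
  increasing order, so that \<open>\<alpha>\<^sub>i\<close> is the list entry with index \<open>i - 1\<close>.
\<close>
definition pq_chain :: "'a::field poly \<Rightarrow> 'a poly \<Rightarrow> 'a list \<Rightarrow> bool" where
  "pq_chain p q as \<longleftrightarrow>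
     as \<noteq> [] \<and> sorted_wrt preceq as \<and> poly p (hd as) = 0 \<and> poly q (last as) = 0"

definition gapless :: "'a::field list \<Rightarrow> bool" where
  "gapless as \<longleftrightarrow> (\<forall>i. Suc i < length as \<longrightarrow> as ! Suc i - as ! i \<in> {0, 1})"

lemma shift_simps:
  "shift c (f * k) = shift c f * shift c k" "shift c (f + k) = shift c f + shift c k"
  "shift c (f - k) = shift c f - shift c k" "shift c (smult a f) = smult a (shift c f)"
  "shift c [:a:] = [:a:]" "shift c [:0, 1:] = [:c, 1:]"
  by (simp_all add: shift_def pcompose_mult pcompose_add pcompose_diff pcompose_smult pcompose_pCons)

lemma shift_shift: "shift c (shift d f) = shift (c + d) f"
  by (simp add: shift_def pcompose_assoc [symmetric] pcompose_pCons add.commute)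

lemma shift_0 [simp]: "shift 0 f = f"
  by (simp add: shift_def pcompose_idR)

lemma q_poly_dvd:
  assumes "X \<subseteq># proots f"
  shows "q_poly X dvd (f :: 'a::field poly)"
proof (cases "f = 0")
  case False
  then show ?thesis using assms
  proof (induction X arbitrary: f)
    case (add a X)
    from add.prems have "a \<in># proots f"
      by (meson mset_subset_eqD union_single_eq_member)
    with add.prems obtain k where k: "f = [:-a, 1:] * k"
      by (auto simp: poly_eq_0_iff_dvd elim: dvdE)
    with add.prems have "k \<noteq> 0" "proots f = add_mset a (proots k)"
      by (auto simp: proots_mult simp del: mult_pCons_left)
    with add.IH [of k] add.prems have "q_poly X dvd k" by simp
    then have "[:-a, 1:] * q_poly X dvd [:-a, 1:] * k" by (rule mult_dvd_mono [OF dvd_refl])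
    then show ?case by (simp add: q_poly_def k del: mult_pCons_left)
  qed (simp add: q_poly_def)
qed simp

lemma p_poly_mult:
  assumes "X \<subseteq># proots (u + [:C:])"
  shows "p_poly u C X * shift (-1) (q_poly X) = shift (-1) u + [:C:]"
proof -
  from q_poly_dvd [OF assms] obtain k where "u + [:C:] = q_poly X * k" by (elim dvdE)
  then have "shift (-1) (u + [:C:]) = shift (-1) (q_poly X) * shift (-1) k"
    by (simp add: shift_simps)
  then have "shift (-1) (q_poly X) dvd shift (-1) u + [:C:]"
    by (simp add: shift_simps)
  then show ?thesis by (simp add: p_poly_def)
qed

lemma smith_module_A:
  fixes u :: "'a::field poly"
  assumes g: "g = shift (-1) u - u" and X: "X \<subseteq># proots (u + [:C:])"
  shows "smith_module smult g act_h (act_x X) (act_y u C X)"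
proof -
  interpret vector_space "smult :: 'a \<Rightarrow> 'a poly \<Rightarrow> 'a poly"
    by unfold_locales (simp_all add: smult_add_right smult_add_left)
  have lin: "Vector_Spaces.linear smult smult F"
    if "\<And>a b. F (a + b) = F a + F b" "\<And>c a. F (smult c a) = smult c (F a)"
    for F :: "'a poly \<Rightarrow> 'a poly"
    by unfold_locales (use that in auto)
  note p = p_poly_mult [OF X]
  have "shift 1 (p_poly u C X * shift (-1) (q_poly X)) = u + [:C:]"
    unfolding p by (simp add: shift_simps shift_shift)
  then have p': "shift 1 (p_poly u C X) * q_poly X = u + [:C:]"
    by (simp add: shift_simps shift_shift)
  have pow: "(act_h ^^ i) v = monom 1 i * v" for i and v :: "'a poly"
    by (induction i) (simp_all add: act_h_def monom_Suc)
  have gv: "(\<Sum>i\<le>degree g. smult (coeff g i) ((act_h ^^ i) v)) = g * v" for v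
  proof -
    have "(\<Sum>i\<le>degree g. smult (coeff g i) ((act_h ^^ i) v)) = (\<Sum>i\<le>degree g. monom (coeff g i) i) * v"
      by (simp add: pow sum_distrib_right smult_monom flip: mult_smult_left)
    then show ?thesis by (simp add: poly_as_sum_of_monoms)
  qed
  have yx: "act_y u C X (act_x X v) = (shift (-1) u + [:C:]) * v" for v
    unfolding act_y_def act_x_def p [symmetric] by (simp add: shift_simps shift_shift)
  have xy: "act_x X (act_y u C X v) = (u + [:C:]) * v" for v
    unfolding act_y_def act_x_def p' [symmetric] by (simp add: shift_simps shift_shift)
  have s: "shift c (pCons 0 v) = [:c, 1:] * shift c v" for c and v :: "'a poly"
    by (simp add: shift_def pcompose_pCons)
  show ?thesis
  proof unfold_locales
    fix v
    show "act_y u C X (act_x X v) - act_x X (act_y u C X v)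
      = (\<Sum>i\<le>degree g. smult (coeff g i) ((act_h ^^ i) v))"
      unfolding gv yx xy by (simp add: g algebra_simps)
  qed (auto simp: act_h_def act_x_def act_y_def s shift_simps algebra_simps smult_add_right)
qed

end

theory Submission
  imports Defs
begin

text \<open>
  Write \<open>p\<close> and \<open>q\<close> for the two polynomials defining the actions of \<open>y\<close> and \<open>x\<close>. Evaluating
  the divisibilities \<open>t | t(h-1) p\<close> and \<open>t | t(h+1) q\<close> at a root \<open>\<beta>\<close> of \<open>t\<close> shows that
  \<open>\<beta> - 1\<close> is again a root of \<open>t\<close> unless \<open>p(\<beta>) = 0\<close>, and that \<open>\<beta> + 1\<close> is again a root of \<open>t\<close>
  unless \<open>q(\<beta>) = 0\<close>. In characteristic zero a nonzero \<open>t\<close> cannot have infinitely many roots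
  along a line \<open>\<beta> + \<int>\<close>, so walking up and down along the roots of \<open>t\<close> has to stop. Walking up,
  then down, then up again, and stopping at the first opportunity each time, produces a
  consecutive run \<open>a, a+1, \<dots>, a+n\<close> of roots of \<open>t\<close> which meets the roots of \<open>p\<close> only in its first
  element and the roots of \<open>q\<close> only in its last one (\<open>tight_run_exists\<close>).

  Conversely the product of \<open>h - (a+i)\<close> over any consecutive run from a root of \<open>p\<close> to a
  root of \<open>q\<close> satisfies both divisibilities (\<open>run_poly_stable\<close>). So below every nonzero \<open>t \<noteq> 1\<close> in
  the poset lies the polynomial of a tight run. Moreover a tight run contains no smaller run from a
  root of \<open>p\<close> to a root of \<open>q\<close>, so these polynomials are exactly the nonzero minimal elements, and
  \<open>0\<close> is minimal iff there is no such run at all; as the roots of \<open>p\<close> are the \<open>\<alpha> + 1\<close> with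
  \<open>\<alpha> \<in> Y\<close>, the latter says that \<open>X - Y\<close> contains no positive integer.

  Finally, submodules of \<open>A\<^sub>C(X)\<close> are ideals of the principal ideal domain of polynomials in \<open>h\<close>,
  and an ideal is stable under \<open>x\<close> and \<open>y\<close> iff its generator satisfies the two divisibilities.
  Hence simplicity means that the poset is \<open>{0, 1}\<close> (\<open>simple_A_iff\<close>).
\<close>

section \<open>Polynomials with prescribed roots\<close>

lemma poly_shift [simp]: "poly (shift c f) x = poly f (x + c)"
  by (simp add: shift_def poly_pcompose add.commute)

lemma q_poly_nonzero [simp]: "q_poly X \<noteq> (0 :: 'a::field poly)"
  by (induction X) (simp_all add: q_poly_def del: mult_pCons_left)

lemma proots_q_poly [simp]: "proots (q_poly X) = (X :: 'a::field multiset)"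
proof (induction X)
  case (add a X)
  have "q_poly (add_mset a X) = [:-a, 1:] * q_poly X" by (simp add: q_poly_def)
  then show ?case using add by (simp add: proots_mult del: mult_pCons_left)
qed (simp add: q_poly_def)

lemma poly_q_poly_eq_0_iff: "poly (q_poly X) x = 0 \<longleftrightarrow> x \<in># (X :: 'a::field multiset)"
  using set_count_proots[OF q_poly_nonzero, of X] by auto

lemma monic_q_poly [simp]: "lead_coeff (q_poly X) = (1 :: 'a::field)"
  by (induction X) (simp_all add: q_poly_def lead_coeff_mult del: mult_pCons_left)

lemma degree_q_poly [simp]: "degree (q_poly X) = size (X :: 'a::field multiset)"
proof (induction X)
  case (add a X)
  have "q_poly (add_mset a X) = [:-a, 1:] * q_poly X" by (simp add: q_poly_def)
  also have "degree \<dots> = degree [:-a, 1:] + degree (q_poly X)" by (intro degree_mult_eq) simp_all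
  finally show ?case using add by simp
qed (simp add: q_poly_def)

lemma monic_dvd_imp_eq:
  fixes s t :: "'a::field poly"
  assumes "s dvd t" "degree t \<le> degree s" "lead_coeff s = 1" "lead_coeff t = 1"
  shows "s = t"
proof -
  from assms(1) obtain k where k: "t = s * k" by (elim dvdE)
  have "lead_coeff k = 1" using assms(3,4) unfolding k lead_coeff_mult by simp
  then have "k \<noteq> 0" by auto
  moreover have "s \<noteq> 0" using assms(3) by auto
  ultimately have "degree k = 0" using assms(2) by (simp add: k degree_mult_eq)
  then have "k = 1"
    using \<open>lead_coeff k = 1\<close> by (metis degree_eq_zeroE lead_coeff_pCons(2) one_pCons)
  then show ?thesis by (simp add: k)
qed

lemma monic_dvd_antisym:
  fixes s t :: "'a::field poly"
  assumes "s dvd t" "t dvd s" "lead_coeff s = 1" "lead_coeff t = 1"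
  shows "s = t"
proof -
  have "s \<noteq> 0" using assms(3) by auto
  then show ?thesis using assms by (intro monic_dvd_imp_eq dvd_imp_degree_le)
qed

lemma monic_eq_q_poly:
  fixes t :: "'a::field poly"
  assumes "lead_coeff t = 1" "proots t = M" "degree t = size M"
  shows "t = q_poly M"
  using assms by (intro monic_dvd_imp_eq[symmetric] q_poly_dvd monic_q_poly) simp_all

lemma q_poly_dvd_if_roots:
  fixes f :: "'a::field poly"
  assumes "distinct as" "\<And>x. x \<in> set as \<Longrightarrow> poly f x = 0"
  shows "q_poly (mset as) dvd f"
proof (cases "f = 0")
  case False
  have "mset as \<subseteq># proots f"
  proof (rule mset_subset_eqI)
    fix x
    show "count (mset as) x \<le> count (proots f) x"
    proof (cases "x \<in> set as")
      case True
      then have "count (mset as) x = 1" using assms(1) by (simp add: distinct_count_atmost_1)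
      moreover have "x \<in># proots f" using assms(2)[OF True] False by simp
      then have "count (proots f) x \<ge> 1" by (simp only: count_greater_eq_one_iff)
      ultimately show ?thesis by simp
    next
      case False
      then show ?thesis by (metis count_mset_0_iff le0)
    qed
  qed
  then show ?thesis by (rule q_poly_dvd)
qed simp

section \<open>Stable polynomials and consecutive runs of roots\<close>

definition stable :: "'a::comm_ring_1 poly \<Rightarrow> 'a poly \<Rightarrow> 'a poly \<Rightarrow> bool" where
  "stable p q t \<longleftrightarrow> t dvd shift (-1) t * p \<and> t dvd shift 1 t * q"

definition run :: "'a::ring_1 \<Rightarrow> nat \<Rightarrow> 'a list" where
  "run a n = map (\<lambda>i. a + of_nat i) [0..<Suc n]"

definition run_poly :: "'a::field \<Rightarrow> nat \<Rightarrow> 'a poly" where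
  "run_poly a n = q_poly (mset (run a n))"

lemma length_run [simp]: "length (run a n) = Suc n"
  by (simp add: run_def)

lemma nth_run [simp]: "i \<le> n \<Longrightarrow> run a n ! i = a + of_nat i"
  unfolding run_def by (subst nth_map) (simp_all del: upt_Suc)

lemma run_nonempty [simp]: "run a n \<noteq> []"
  by (simp add: run_def)

lemma hd_run [simp]: "hd (run a n) = a"
  by (simp add: hd_conv_nth)

lemma last_run [simp]: "last (run a n) = a + of_nat n"
  by (simp add: last_conv_nth)

lemma in_set_run_iff: "x \<in> set (run a n) \<longleftrightarrow> (\<exists>i\<le>n. x = a + of_nat i)"
  by (auto simp: run_def less_Suc_eq_le image_iff simp del: upt_Suc)

lemma distinct_run [simp]: "distinct (run (a :: 'a::field_char_0) n)"
  by (auto simp: run_def distinct_map inj_on_def simp del: upt_Suc)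

lemma poly_run_poly_eq_0_iff:
  "poly (run_poly a n) x = 0 \<longleftrightarrow> (\<exists>i\<le>n. x = a + of_nat i)"
  by (simp add: run_poly_def poly_q_poly_eq_0_iff in_set_run_iff)

lemma monic_run_poly [simp]: "lead_coeff (run_poly a n) = 1"
  unfolding run_poly_def by (rule monic_q_poly)

lemma run_poly_nonzero [simp]: "run_poly a n \<noteq> 0"
  by (simp add: run_poly_def)

lemma run_poly_neq_1 [simp]: "run_poly a n \<noteq> 1"
proof
  assume "run_poly a n = 1"
  then have "degree (run_poly a n) = 0" by simp
  then show False by (simp add: run_poly_def)
qed

lemma run_poly_dvd_if_roots:
  fixes f :: "'a::field_char_0 poly"
  assumes "\<And>i. i \<le> n \<Longrightarrow> poly f (a + of_nat i) = 0"
  shows "run_poly a n dvd f"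
  unfolding run_poly_def using assms by (intro q_poly_dvd_if_roots) (auto simp: in_set_run_iff)

text \<open>
  Shifting the run by one in either direction loses only one of its end points, which is
  restored by the factor \<open>p\<close> or \<open>q\<close>.
\<close>

lemma run_poly_stable:
  fixes p q :: "'a::field_char_0 poly"
  assumes "poly p a = 0" "poly q (a + of_nat n) = 0"
  shows "stable p q (run_poly a n)"
  unfolding stable_def
proof (intro conjI run_poly_dvd_if_roots)
  fix i assume "i \<le> n"
  show "poly (shift (-1) (run_poly a n) * p) (a + of_nat i) = 0"
  proof (cases i)
    case (Suc j)
    then have "poly (run_poly a n) (a + of_nat j) = 0"
      using \<open>i \<le> n\<close> by (subst poly_run_poly_eq_0_iff) (auto intro: exI[of _ j])
    then show ?thesis by (simp add: Suc)
  qed (use assms in simp)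
  show "poly (shift 1 (run_poly a n) * q) (a + of_nat i) = 0"
  proof (cases "i = n")
    case False
    then have "poly (run_poly a n) (a + of_nat (Suc i)) = 0"
      using \<open>i \<le> n\<close> unfolding poly_run_poly_eq_0_iff by (intro exI[of _ "Suc i"]) auto
    then show ?thesis by (simp add: algebra_simps)
  qed (use assms in simp)
qed

text \<open>
  A walk with nonzero step \<open>c\<close> visits infinitely many points, whereas \<open>t\<close> has
  only finitely many roots; so if \<open>P\<close> is the only thing that can stop a walk inside the
  roots of \<open>t\<close>, it is reached.
\<close>

lemma walk_along_roots:
  fixes t :: "'a::field_char_0 poly"
  assumes "t \<noteq> 0" "c \<noteq> 0" "poly t b = 0"
    and step: "\<And>x. poly t x = 0 \<Longrightarrow> \<not> P x \<Longrightarrow> poly t (x + c) = 0"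
  shows "\<exists>n. P (b + of_nat n * c) \<and> (\<forall>i<n. \<not> P (b + of_nat i * c)) \<and>
    (\<forall>i\<le>n. poly t (b + of_nat i * c) = 0)"
proof -
  have root: "poly t (b + of_nat i * c) = 0"
    if "\<And>j. j < i \<Longrightarrow> \<not> P (b + of_nat j * c)" for i
    using that
  proof (induction i)
    case (Suc i)
    then have "poly t (b + of_nat i * c + c) = 0" by (intro step) auto
    then show ?case by (simp add: algebra_simps)
  qed (use assms in simp)
  have "\<exists>n. P (b + of_nat n * c)"
  proof (rule ccontr)
    assume "\<nexists>n. P (b + of_nat n * c)"
    then have "range (\<lambda>i. b + of_nat i * c) \<subseteq> {x. poly t x = 0}" using root by auto
    then have "finite (range (\<lambda>i. b + of_nat i * c))"
      using poly_roots_finite[OF \<open>t \<noteq> 0\<close>] finite_subset by blast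
    moreover have "inj (\<lambda>i::nat. b + of_nat i * c)"
      using \<open>c \<noteq> 0\<close> by (auto simp: inj_on_def)
    ultimately show False using range_inj_infinite by blast
  qed
  then obtain n where "P (b + of_nat n * c)" "\<And>i. i < n \<Longrightarrow> \<not> P (b + of_nat i * c)"
    using exists_least_iff[of "\<lambda>n. P (b + of_nat n * c)"] by auto
  then show ?thesis using root by (intro exI[of _ n]) auto
qed

definition tight_run :: "'a::field poly \<Rightarrow> 'a poly \<Rightarrow> 'a \<Rightarrow> nat \<Rightarrow> bool" where
  "tight_run p q a n \<longleftrightarrow> poly p a = 0 \<and> poly q (a + of_nat n) = 0 \<and>
     (\<forall>i<n. poly q (a + of_nat i) \<noteq> 0) \<and> (\<forall>i. 0 < i \<and> i \<le> n \<longrightarrow> poly p (a + of_nat i) \<noteq> 0)"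

text \<open>
  Climb from some root of \<open>t\<close> to the first root \<open>b\<close> of \<open>q\<close>, then descend to the first root \<open>a\<close>
  of \<open>p\<close>: between \<open>a\<close> and \<open>b\<close> there is no further root of \<open>p\<close>. Climbing once more from \<open>a\<close> to
  the first root of \<open>q\<close> goes no further than \<open>b\<close>, so it keeps this property.
\<close>

lemma tight_run_exists:
  fixes t :: "'a::{alg_closed_field, field_char_0} poly"
  assumes "stable p q t" "lead_coeff t = 1" "t \<noteq> 1"
  obtains a n where "tight_run p q a n" "\<And>i. i \<le> n \<Longrightarrow> poly t (a + of_nat i) = 0"
proof -
  have "t \<noteq> 0" using assms(2) by auto
  have "degree t \<noteq> 0"
    using assms(2,3) by (metis degree_eq_zeroE lead_coeff_pCons(2) one_pCons)
  then obtain r where r: "poly t r = 0" using alg_closed_imp_poly_has_root[of t] by auto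
  have up: "poly t (x + 1) = 0" if "poly t x = 0" "poly q x \<noteq> 0" for x
  proof -
    have "poly (shift 1 t * q) x = 0"
      using assms(1) that(1) unfolding stable_def by (metis dvdE mult_zero_left poly_mult)
    then show ?thesis using that by simp
  qed
  have down: "poly t (x + (- 1)) = 0" if "poly t x = 0" "poly p x \<noteq> 0" for x
  proof -
    have "poly (shift (-1) t * p) x = 0"
      using assms(1) that(1) unfolding stable_def by (metis dvdE mult_zero_left poly_mult)
    then show ?thesis using that by simp
  qed
  have minus_one: "- 1 \<noteq> (0 :: 'a)" by simp
  obtain k where k: "poly q (r + of_nat k * 1) = 0"
    "\<And>i. i < k \<Longrightarrow> poly q (r + of_nat i * 1) \<noteq> 0"
    "\<And>i. i \<le> k \<Longrightarrow> poly t (r + of_nat i * 1) = 0"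
    using walk_along_roots[of t 1 r "\<lambda>x. poly q x = 0", OF \<open>t \<noteq> 0\<close> one_neq_zero r up] by blast
  define b where "b = r + of_nat k * 1"
  have tb: "poly t b = 0" unfolding b_def by (rule k(3)) simp
  obtain m where m: "poly p (b + of_nat m * (- 1)) = 0"
    "\<And>i. i < m \<Longrightarrow> poly p (b + of_nat i * (- 1)) \<noteq> 0"
    "\<And>i. i \<le> m \<Longrightarrow> poly t (b + of_nat i * (- 1)) = 0"
    using walk_along_roots[of t "- 1" b "\<lambda>x. poly p x = 0", OF \<open>t \<noteq> 0\<close> minus_one tb down] by blast
  define a where "a = b + of_nat m * (- 1)"
  have ta: "poly t a = 0" unfolding a_def by (rule m(3)) simp
  obtain n where n: "poly q (a + of_nat n * 1) = 0"
    "\<And>i. i < n \<Longrightarrow> poly q (a + of_nat i * 1) \<noteq> 0"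
    "\<And>i. i \<le> n \<Longrightarrow> poly t (a + of_nat i * 1) = 0"
    using walk_along_roots[of t 1 a "\<lambda>x. poly q x = 0", OF \<open>t \<noteq> 0\<close> one_neq_zero ta up] by blast
  have "n \<le> m"
  proof (rule ccontr)
    assume "\<not> n \<le> m"
    then have "poly q (a + of_nat m * 1) \<noteq> 0" by (intro n(2)) simp
    then show False using k(1) by (simp add: a_def b_def)
  qed
  have "poly p (a + of_nat i) \<noteq> 0" if "0 < i" "i \<le> n" for i
  proof -
    have "a + of_nat i = b + of_nat (m - i) * (- 1)"
      using that \<open>n \<le> m\<close> by (simp add: a_def of_nat_diff)
    moreover have "poly p (b + of_nat (m - i) * (- 1)) \<noteq> 0"
      using that \<open>n \<le> m\<close> by (intro m(2)) simp
    ultimately show ?thesis by (simp only: not_False_eq_True)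
  qed
  then have "tight_run p q a n" using m(1) n by (simp add: tight_run_def a_def)
  then show ?thesis using that[of a n] n(3) by simp
qed

section \<open>Minimal stable polynomials\<close>

definition stable_monics :: "'a::field poly \<Rightarrow> 'a poly \<Rightarrow> 'a poly set" where
  "stable_monics p q = {t. lead_coeff t = 1 \<and> stable p q t} \<union> {0}"

lemma run_poly_in_stable_monics:
  fixes p q :: "'a::field_char_0 poly"
  assumes "poly p a = 0" "poly q (a + of_nat n) = 0"
  shows "run_poly a n \<in> stable_monics p q - {1}"
  using run_poly_stable[OF assms] by (simp add: stable_monics_def)

lemma stable_monics_trivial_iff:
  fixes p q :: "'a::{alg_closed_field, field_char_0} poly"
  shows "stable_monics p q - {1} = {0} \<longleftrightarrow> (\<nexists>a n. poly p a = 0 \<and> poly q (a + of_nat n) = 0)"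
proof
  assume "stable_monics p q - {1} = {0}"
  then show "\<nexists>a n. poly p a = 0 \<and> poly q (a + of_nat n) = 0"
    using run_poly_in_stable_monics[of p _ q] by (metis run_poly_nonzero singletonD)
next
  assume none: "\<nexists>a n. poly p a = 0 \<and> poly q (a + of_nat n) = 0"
  have "t = 0" if "t \<in> stable_monics p q - {1}" for t
  proof (rule ccontr)
    assume "t \<noteq> 0"
    then have "stable p q t" "lead_coeff t = 1" "t \<noteq> 1"
      using that by (auto simp: stable_monics_def)
    then obtain a n where "tight_run p q a n" by (rule tight_run_exists)
    then show False using none unfolding tight_run_def by blast
  qed
  then show "stable_monics p q - {1} = {0}" by (auto simp: stable_monics_def)
qed

lemma minimal_zero_iff:
  fixes p q :: "'a::{alg_closed_field, field_char_0} poly"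
  shows "minimal_dvd_in (stable_monics p q - {1}) 0 \<longleftrightarrow>
    (\<nexists>a n. poly p a = 0 \<and> poly q (a + of_nat n) = 0)"
  unfolding stable_monics_trivial_iff[symmetric]
  by (auto simp: minimal_dvd_in_def stable_monics_def)

text \<open>
  If \<open>s | run_poly a n\<close> is stable and not \<open>1\<close>, then the tight run among the roots of \<open>s\<close> lies inside
  \<open>a, \<dots>, a+n\<close>. It starts at a root of \<open>p\<close> and ends at a root of \<open>q\<close>, and the only candidates for
  these are \<open>a\<close> and \<open>a+n\<close>; so \<open>s\<close> vanishes on the whole run.
\<close>

lemma minimal_nonzero_iff:
  fixes p q t :: "'a::{alg_closed_field, field_char_0} poly"
  assumes "t \<noteq> 0"
  shows "minimal_dvd_in (stable_monics p q - {1}) t \<longleftrightarrow>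
    (\<exists>a n. tight_run p q a n \<and> t = run_poly a n)"
proof
  assume min: "minimal_dvd_in (stable_monics p q - {1}) t"
  then have "stable p q t" "lead_coeff t = 1" "t \<noteq> 1"
    using assms by (auto simp: minimal_dvd_in_def stable_monics_def)
  then obtain a n where an: "tight_run p q a n" "\<And>i. i \<le> n \<Longrightarrow> poly t (a + of_nat i) = 0"
    using tight_run_exists by blast
  have "run_poly a n \<in> stable_monics p q - {1}"
    using an(1) by (intro run_poly_in_stable_monics) (auto simp: tight_run_def)
  moreover have "run_poly a n dvd t" using an(2) by (rule run_poly_dvd_if_roots)
  ultimately have "run_poly a n = t" using min by (auto simp: minimal_dvd_in_def)
  then show "\<exists>a n. tight_run p q a n \<and> t = run_poly a n" using an(1) by blast
next
  assume "\<exists>a n. tight_run p q a n \<and> t = run_poly a n"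
  then obtain a n where an: "tight_run p q a n" and t: "t = run_poly a n" by blast
  show "minimal_dvd_in (stable_monics p q - {1}) t"
    unfolding minimal_dvd_in_def
  proof (intro conjI ballI impI)
    show "t \<in> stable_monics p q - {1}"
      unfolding t using an by (intro run_poly_in_stable_monics) (auto simp: tight_run_def)
  next
    fix s assume s: "s \<in> stable_monics p q - {1}" "s dvd t"
    then have s': "stable p q s" "lead_coeff s = 1" "s \<noteq> 1"
      using assms by (auto simp: stable_monics_def)
    then obtain b m where bm: "tight_run p q b m" "\<And>i. i \<le> m \<Longrightarrow> poly s (b + of_nat i) = 0"
      using tight_run_exists by blast
    have root: "\<exists>j\<le>n. x = a + of_nat j" if "poly s x = 0" for x
      using that s(2) unfolding t poly_run_poly_eq_0_iff[symmetric]
      by (metis dvdE mult_zero_left poly_mult)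
    obtain j where j: "j \<le> n" "b = a + of_nat j" using root bm(2)[of 0] by auto
    obtain k where k: "k \<le> n" "b + of_nat m = a + of_nat k" using root bm(2)[of m] by auto
    have "j = 0" using an bm(1) j by (auto simp: tight_run_def)
    moreover have "k = n" using an bm(1) k by (auto simp: tight_run_def le_less)
    ultimately have "b = a" "m = n" using j k by auto
    then have "t dvd s" using bm(2) unfolding t by (intro run_poly_dvd_if_roots) simp
    then show "s = t" using s(2) s'(2) t by (intro monic_dvd_antisym) auto
  qed
qed

section \<open>Tight runs as chains\<close>

lemma gapless_distinct_eq_run:
  fixes as :: "'a::field list"
  assumes "as \<noteq> []" "gapless as" "distinct as"
  shows "as = run (hd as) (length as - 1)"
proof (rule nth_equalityI)
  fix i assume "i < length as"
  then have "as ! i = hd as + of_nat i"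
  proof (induction i)
    case (Suc i)
    have "as ! Suc i - as ! i \<in> {0, 1}" using assms(2) Suc.prems by (simp add: gapless_def)
    moreover have "as ! Suc i \<noteq> as ! i"
      using assms(3) Suc.prems by (simp add: nth_eq_iff_index_eq)
    ultimately have "as ! Suc i = as ! i + 1" by (auto simp: algebra_simps)
    then show ?case using Suc by simp
  qed (use assms in \<open>simp add: hd_conv_nth\<close>)
  then show "as ! i = run (hd as) (length as - 1) ! i" using \<open>i < length as\<close> by simp
qed (use assms in simp)

lemma sorted_run: "sorted_wrt prec (run (a :: 'a::field_char_0) n)"
  unfolding sorted_wrt_iff_nth_less
proof (intro allI impI)
  fix i j assume ij: "i < j" "j < length (run a n)"
  then have "run a n ! j - run a n ! i = of_nat (j - i)" by (simp add: of_nat_diff)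
  then show "prec (run a n ! i) (run a n ! j)"
    using ij unfolding prec_def preceq_def by (intro conjI exI[of _ "j - i"]) auto
qed

lemma gapless_run: "gapless (run (a :: 'a::field) n)"
  by (simp add: gapless_def)

text \<open>
  A gapless chain without repetitions has all its steps equal to \<open>1\<close>, so it is a run. Tightness is
  condition (i) together with (ii), because the roots of \<open>p\<close> are \<open>Y\<close> moved up by one.
\<close>

lemma tight_run_iff_chain:
  fixes p q t :: "'a::field_char_0 poly"
  assumes monic: "lead_coeff t = 1"
    and q: "\<And>x. poly q x = 0 \<longleftrightarrow> x \<in># X" and p: "\<And>x. poly p x = 0 \<longleftrightarrow> x - 1 \<in># Y"
  shows "(\<exists>a n. tight_run p q a n \<and> t = run_poly a n) \<longleftrightarrow>
    (\<exists>as. proots t = mset as \<and> degree t = length as \<and> pq_chain p q as \<and> gapless as \<and>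
      distinct as \<and> sorted_wrt prec as \<and>
      \<not> (\<exists>i. Suc i < length as \<and> as ! i \<in># X) \<and>
      \<not> (\<exists>i. 0 < i \<and> i < length as \<and> as ! i - 1 \<in># Y))"
    (is "?L \<longleftrightarrow> (\<exists>as. ?R as)")
proof
  assume ?L
  then obtain a n where an: "tight_run p q a n" and t: "t = run_poly a n" by blast
  have "sorted_wrt preceq (run a n)"
    using sorted_run by (rule sorted_wrt_mono_rel[rotated]) (simp add: prec_def)
  moreover have "\<not> (\<exists>i. Suc i < length (run a n) \<and> run a n ! i \<in># X)"
    using an by (auto simp: tight_run_def q)
  moreover have "\<not> (\<exists>i. 0 < i \<and> i < length (run a n) \<and> run a n ! i - 1 \<in># Y)"
    using an by (auto simp: tight_run_def p)
  ultimately have "?R (run a n)"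
    using an by (simp add: t run_poly_def pq_chain_def gapless_run sorted_run tight_run_def)
  then show "\<exists>as. ?R as" by blast
next
  assume "\<exists>as. ?R as"
  then obtain as where as: "?R as" by blast
  define a n where "a = hd as" and "n = length as - 1"
  have ne: "as \<noteq> []" using as by (simp add: pq_chain_def)
  have run: "as = run a n"
    unfolding a_def n_def using as ne by (intro gapless_distinct_eq_run) auto
  have q': "\<not> (\<exists>i. Suc i < length (run a n) \<and> run a n ! i \<in># X)"
    and p': "\<not> (\<exists>i. 0 < i \<and> i < length (run a n) \<and> run a n ! i - 1 \<in># Y)"
    using as unfolding run by blast+
  have "poly q (a + of_nat i) \<noteq> 0" if "i < n" for i
    using q' that by (auto simp: q dest: spec[of _ i])
  moreover have "poly p (a + of_nat i) \<noteq> 0" if "0 < i" "i \<le> n" for i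
    using p' that by (auto simp: p dest: spec[of _ i])
  moreover have "poly p a = 0" "poly q (a + of_nat n) = 0"
    using as unfolding run pq_chain_def by simp_all
  ultimately have "tight_run p q a n" by (simp add: tight_run_def)
  moreover have "t = run_poly a n"
    unfolding run_poly_def using as run monic by (intro monic_eq_q_poly) auto
  ultimately show ?L by blast
qed

section \<open>Submodules as ideals\<close>

text \<open>
  The generator is a nonzero element of least degree: division by it leaves no remainder.
\<close>

lemma ideal_has_monic_generator:
  fixes W :: "'a::field poly set"
  assumes add: "\<And>f g. f \<in> W \<Longrightarrow> g \<in> W \<Longrightarrow> f + g \<in> W" and "0 \<in> W"
    and scale: "\<And>c f. f \<in> W \<Longrightarrow> smult c f \<in> W"
    and h: "\<And>f. f \<in> W \<Longrightarrow> pCons 0 f \<in> W" and "W \<noteq> {0}"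
  shows "\<exists>d. lead_coeff d = 1 \<and> W = {f. d dvd f}"
proof -
  have mult: "k * f \<in> W" if "f \<in> W" for k f
    by (induction k) (use that in \<open>simp_all add: \<open>0 \<in> W\<close> add scale h\<close>)
  have "\<exists>f. f \<in> W \<and> f \<noteq> 0" using \<open>0 \<in> W\<close> \<open>W \<noteq> {0}\<close> by auto
  then obtain f where f: "f \<in> W" "f \<noteq> 0"
    and least: "\<And>k. k \<in> W \<Longrightarrow> k \<noteq> 0 \<Longrightarrow> degree f \<le> degree k"
    using ex_has_least_nat[of "\<lambda>f. f \<in> W \<and> f \<noteq> 0" _ degree] by blast
  define d where "d = smult (inverse (lead_coeff f)) f"
  have d: "lead_coeff d = 1" "d \<noteq> 0" "degree d = degree f" "d \<in> W"
    using f scale by (auto simp: d_def)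
  have "d dvd k" if "k \<in> W" for k
  proof (rule ccontr)
    assume "\<not> d dvd k"
    then have nz: "k mod d \<noteq> 0" by (simp add: mod_eq_0_iff_dvd)
    have "k mod d = k + (- (k div d)) * d" by (simp add: minus_div_mult_eq_mod[symmetric])
    also have "\<dots> \<in> W" using that mult[OF d(4)] by (intro add)
    finally have "degree f \<le> degree (k mod d)" using nz by (intro least)
    moreover have "degree (k mod d) < degree d" using degree_mod_less[OF d(2), of k] nz by auto
    ultimately show False using d(3) by simp
  qed
  moreover have "k \<in> W" if "d dvd k" for k
    using that mult[OF d(4)] by (metis dvdE mult.commute)
  ultimately have "W = {f. d dvd f}" by blast
  then show ?thesis using d(1) by blast
qed

lemma simple_A_iff:
  fixes u :: "'a::field poly"
  assumes g: "g = shift (-1) u - u" and X: "X \<subseteq># proots (u + [:C:])"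
  shows "simple_A g u C X \<longleftrightarrow> stable_monics (p_poly u C X) (q_poly X) - {1} = {0}"
proof -
  interpret smith_module smult g act_h "act_x X" "act_y u C X"
    by (rule smith_module_A[OF g X])
  let ?p = "p_poly u C X" and ?q = "q_poly X"
  have submodule_iff: "submodule {f. t dvd f} \<longleftrightarrow> stable ?p ?q t" for t
  proof
    assume "submodule {f. t dvd f}"
    then have "act_x X t \<in> {f. t dvd f}" "act_y u C X t \<in> {f. t dvd f}"
      unfolding submodule_def image_subset_iff by simp_all
    then show "stable ?p ?q t" by (simp add: stable_def act_x_def act_y_def)
  next
    assume st: "stable ?p ?q t"
    have "t dvd act_x X f" "t dvd act_y u C X f" if tf: "t dvd f" for f
    proof -
      obtain k where k: "f = t * k" using tf by (elim dvdE)
      have "act_x X f = shift 1 t * ?q * shift 1 k" "act_y u C X f = shift (-1) t * ?p * shift (-1) k"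
        by (simp_all add: act_x_def act_y_def k shift_simps mult_ac)
      then show "t dvd act_x X f" "t dvd act_y u C X f"
        using st by (auto simp: stable_def intro: dvd_mult2)
    qed
    then show "submodule {f. t dvd f}"
      by (auto simp: submodule_def subspace_def act_h_def dvd_smult
          simp del: mult_pCons_left intro: dvd_add dvd_mult)
  qed
  have gen: "\<exists>d. lead_coeff d = 1 \<and> stable ?p ?q d \<and> W = {f. d dvd f}"
    if "submodule W" "W \<noteq> {0}" for W
  proof -
    have sub: "subspace W" using \<open>submodule W\<close> by (simp add: submodule_def)
    have h: "act_h f \<in> W" if "f \<in> W" for f
      using \<open>submodule W\<close> that by (auto simp: submodule_def)
    have "\<exists>d. lead_coeff d = 1 \<and> W = {f. d dvd f}"
    proof (rule ideal_has_monic_generator)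
      show "pCons 0 f \<in> W" if "f \<in> W" for f using h[OF that] by (simp add: act_h_def)
    qed (use sub \<open>W \<noteq> {0}\<close> in \<open>simp_all add: subspace_add subspace_scale subspace_0\<close>)
    then obtain d where "lead_coeff d = 1" "W = {f. d dvd f}" by blast
    then show ?thesis using that(1) submodule_iff[of d] by blast
  qed
  have unit: "{f. d dvd f} = UNIV \<longleftrightarrow> d = 1" if "lead_coeff d = 1" for d :: "'a poly"
  proof
    assume "{f. d dvd f} = UNIV"
    then have "d dvd 1" by blast
    then show "d = 1" using that by (intro monic_dvd_antisym) auto
  qed auto
  have nontriv: "(UNIV :: 'a poly set) \<noteq> {0}" using one_neq_zero by blast
  show ?thesis
  proof
    assume simple: "simple_A g u C X"
    have "t = 0" if t: "t \<in> stable_monics ?p ?q - {1}" for t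
    proof (rule ccontr)
      assume "t \<noteq> 0"
      then have t': "lead_coeff t = 1" "stable ?p ?q t" "t \<noteq> 1"
        using t by (auto simp: stable_monics_def)
      then have "{f. t dvd f} = {0} \<or> {f. t dvd f} = UNIV"
        using simple submodule_iff[of t] by (auto simp: simple_A_def simple_smith_module_def)
      moreover have "t \<in> {f. t dvd f}" by simp
      ultimately show False using \<open>t \<noteq> 0\<close> unit[OF t'(1)] t'(3) by blast
    qed
    then show "stable_monics ?p ?q - {1} = {0}" by (auto simp: stable_monics_def)
  next
    assume trivial: "stable_monics ?p ?q - {1} = {0}"
    have "W = {0} \<or> W = UNIV" if sub: "submodule W" for W
    proof (rule disjCI)
      assume "W \<noteq> UNIV"
      show "W = {0}"
      proof (rule ccontr)
        assume "W \<noteq> {0}"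
        then obtain d where d: "lead_coeff d = 1" "stable ?p ?q d" "W = {f. d dvd f}"
          using gen[OF sub] by blast
        have "d \<noteq> 1" using \<open>W \<noteq> UNIV\<close> unit[OF d(1)] d(3) by blast
        then have "d \<in> stable_monics ?p ?q - {1}" using d by (simp add: stable_monics_def)
        then show False using d(1) unfolding trivial by simp
      qed
    qed
    then show "simple_A g u C X"
      using nontriv smith_module_axioms by (simp add: simple_A_def simple_smith_module_def)
  qed
qed

section \<open>The minimal elements of the poset\<close>

text \<open>
  Shifting the factorisation that defines \<open>p\<close> up by one gives \<open>p(h+1) q(h) = u(h) + C\<close>, so the roots
  of \<open>p(h+1)\<close> are those of \<open>u + C\<close> left over by \<open>X\<close>.
\<close>

lemma poly_p_poly_eq_0_iff:
  fixes u :: "'a::field poly"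
  assumes X: "X \<subseteq># proots (u + [:C:])" and nz: "u + [:C:] \<noteq> 0"
  shows "poly (p_poly u C X) x = 0 \<longleftrightarrow> x - 1 \<in># proots (u + [:C:]) - X"
proof -
  let ?p = "shift 1 (p_poly u C X)"
  have "shift 1 (p_poly u C X * shift (-1) (q_poly X)) = u + [:C:]"
    unfolding p_poly_mult[OF X] by (simp add: shift_simps shift_shift)
  then have pq: "?p * q_poly X = u + [:C:]" by (simp add: shift_simps shift_shift)
  have "?p \<noteq> 0" using pq nz by (metis mult_zero_left)
  then have "proots (u + [:C:]) = proots ?p + X"
    unfolding pq[symmetric] by (subst proots_mult) auto
  then show ?thesis using \<open>?p \<noteq> 0\<close> by simp
qed

theorem proposition3p19:
  fixes g u t :: "'a :: {alg_closed_field, field_char_0} poly"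
    and C :: 'a and X Y :: "'a multiset"
  assumes "g \<noteq> 0"
    and "g = shift (-1) u - u"
    and "X \<subseteq># proots (u + [:C:])"
    and "Y = proots (u + [:C:]) - X"
    and "lead_coeff t = 1 \<or> t = 0"
  shows "(minimal_dvd_in (L_poset u C X - {1}) t \<longleftrightarrow>
            (t = 0 \<and> diff_set X Y \<inter> {of_nat n | n. n \<ge> 1} = {}) \<or>
            (t \<noteq> 0 \<and>
             (\<exists>as. proots t = mset as \<and> degree t = length as \<and>
                pq_chain (p_poly u C X) (q_poly X) as \<and> gapless as \<and>
                distinct as \<and> sorted_wrt prec as \<and>
                \<not> (\<exists>i. Suc i < length as \<and> as ! i \<in># X) \<and>
                \<not> (\<exists>i. 0 < i \<and> i < length as \<and> as ! i - 1 \<in># Y))))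
       \<and> (diff_set X Y \<inter> {of_nat n | n. n \<ge> 1} = {} \<longleftrightarrow> simple_A g u C X)"
proof -
  let ?p = "p_poly u C X" and ?q = "q_poly X"
  have "u + [:C:] \<noteq> 0"
  proof
    assume "u + [:C:] = 0"
    then have "u = [:- C:]" by (metis eq_neg_iff_add_eq_0 minus_pCons minus_zero)
    then show False using assms(1,2) by (simp add: shift_simps)
  qed
  then have p: "poly ?p x = 0 \<longleftrightarrow> x - 1 \<in># Y" for x
    unfolding assms(4) by (rule poly_p_poly_eq_0_iff[OF assms(3)])
  have q: "poly ?q x = 0 \<longleftrightarrow> x \<in># X" for x by (rule poly_q_poly_eq_0_iff)
  have L: "L_poset u C X = stable_monics ?p ?q"
    by (simp add: L_poset_def stable_monics_def stable_def)
  have no_run: "diff_set X Y \<inter> {of_nat n | n. n \<ge> 1} = {} \<longleftrightarrow>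
      (\<nexists>a n. poly ?p a = 0 \<and> poly ?q (a + of_nat n) = 0)"
  proof -
    \<comment> \<open>A run from \<open>a = \<alpha> + 1\<close> with \<open>\<alpha> \<in> Y\<close> to \<open>\<beta> = a + n\<close> has \<open>\<beta> - \<alpha> = n + 1\<close>.\<close>
    have "(\<exists>\<beta> \<alpha> m. \<beta> \<in># X \<and> \<alpha> \<in># Y \<and> \<beta> - \<alpha> = of_nat m \<and> m \<ge> 1) \<longleftrightarrow>
      (\<exists>a n. poly ?p a = 0 \<and> poly ?q (a + of_nat n) = 0)"
    proof
      assume "\<exists>\<beta> \<alpha> m. \<beta> \<in># X \<and> \<alpha> \<in># Y \<and> \<beta> - \<alpha> = of_nat m \<and> m \<ge> 1"
      then obtain \<beta> \<alpha> m where *: "\<beta> \<in># X" "\<alpha> \<in># Y" "\<beta> - \<alpha> = of_nat m" "m \<ge> 1" by blast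
      from * have "\<alpha> + 1 + of_nat (m - 1) = \<beta>" by (simp add: of_nat_diff algebra_simps)
      then show "\<exists>a n. poly ?p a = 0 \<and> poly ?q (a + of_nat n) = 0"
        using * by (intro exI[of _ "\<alpha> + 1"] exI[of _ "m - 1"]) (simp add: p q)
    next
      assume "\<exists>a n. poly ?p a = 0 \<and> poly ?q (a + of_nat n) = 0"
      then obtain a n where "a - 1 \<in># Y" "a + of_nat n \<in># X" by (auto simp: p q)
      then show "\<exists>\<beta> \<alpha> m. \<beta> \<in># X \<and> \<alpha> \<in># Y \<and> \<beta> - \<alpha> = of_nat m \<and> m \<ge> 1"
        by (intro exI[of _ "a + of_nat n"] exI[of _ "a - 1"] exI[of _ "Suc n"]) simp
    qed
    then show ?thesis unfolding diff_set_def by blast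
  qed
  have "simple_A g u C X \<longleftrightarrow> (\<nexists>a n. poly ?p a = 0 \<and> poly ?q (a + of_nat n) = 0)"
    unfolding simple_A_iff[OF assms(2,3)] by (rule stable_monics_trivial_iff)
  then have simple: "diff_set X Y \<inter> {of_nat n | n. n \<ge> 1} = {} \<longleftrightarrow> simple_A g u C X"
    using no_run by simp
  show ?thesis
  proof (cases "t = 0")
    case True
    then show ?thesis
      using minimal_zero_iff[of ?p ?q] no_run simple unfolding L by simp
  next
    case False
    then have "lead_coeff t = 1" using assms(5) by simp
    then show ?thesis
      unfolding L minimal_nonzero_iff[OF False]
      using tight_run_iff_chain[of t ?q X ?p Y] False p q simple by simp
  qed
qed

end
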